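(* As formal power series in $t$ (with coefficients depending on $x$), $$A(t,x) = (\sec(xt))^{1/x},\qquad B(t,x) = (\sec(xt))^{1/x}\int_0^t (\sec(xz))^{-1/x}\,dz,$$ $$C(t,x) = 1 + \int_0^t (\sec(xy))^{1+\frac{1}{x}}\int_0^y (\sec(xz))^{-1/x}\,dz\,dy,\qquad D(t,x) = \int_0^t (\sec(xz))^{1+\frac{1}{x}}\,dz.$$
   Context: For $\sigma = \sigma_1\ldots\sigma_n\in S_n$, let $\mathrm{mmp}^{(1,0,0,0)}(\sigma)$ be the number of indices $i$ such that there exists $j>i$ with $\sigma_j>\sigma_i$. $UD_n$ is the set of up-down permutations in $S_n$ ($\sigma_1<\sigma_2>\sigma_3<\sigma_4>\cdots$) and $DU_n$ the set of down-up permutations ($\sigma_1>\sigma_2<\sigma_3>\sigma_4<\cdots$). For $n\ge1$ let $A_{2n}(x)=\sum_{\sigma\in UD_{2n}}x^{\mathrm{mmp}^{(1,0,0,0)}(\sigma)}$, $B_{2n-1}(x)=\sum_{\sigma\in UD_{2n-1}}x^{\mathrm{mmp}^{(1,0,0,0)}(\sigma)}$, $C_{2n}(x)=\sum_{\sigma\in DU_{2n}}x^{\mathrm{mmp}^{(1,0,0,0)}(\sigma)}$, $D_{2n-1}(x)=\sum_{\sigma\in DU_{2n-1}}x^{\mathrm{mmp}^{(1,0,0,0)}(\sigma)}$, and define $A(t,x)=1+\sum_{n\ge1}A_{2n}(x)\frac{t^{2n}}{(2n)!}$, $B(t,x)=\sum_{n\ge1}B_{2n-1}(x)\frac{t^{2n-1}}{(2n-1)!}$,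 $C(t,x)=1+\sum_{n\ge1}C_{2n}(x)\frac{t^{2n}}{(2n)!}$, $D(t,x)=\sum_{n\ge1}D_{2n-1}(x)\frac{t^{2n-1}}{(2n-1)!}$. *)

theory Defs
  imports
    "HOL-Computational_Algebra.Computational_Algebra"
    "HOL-Combinatorics.Permutations"
begin

text \<open>A permutation of S_n is a function \<^term>\<open>\<sigma>\<close> with \<^term>\<open>\<sigma> permutes {1..n}\<close>.\<close>

definition mmp1000 :: "nat \<Rightarrow> (nat \<Rightarrow> nat) \<Rightarrow> nat" where
  "mmp1000 n \<sigma> = card {i \<in> {1..n}. \<exists>j \<in> {1..n}. i < j \<and> \<sigma> i < \<sigma> j}"

definition UD :: "nat \<Rightarrow> (nat \<Rightarrow> nat) set" where
  "UD n = {\<sigma>. \<sigma> permutes {1..n} \<and>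
     (\<forall>i \<in> {1..<n}. (odd i \<longrightarrow> \<sigma> i < \<sigma> (Suc i)) \<and> (even i \<longrightarrow> \<sigma> i > \<sigma> (Suc i)))}"

definition DU :: "nat \<Rightarrow> (nat \<Rightarrow> nat) set" where
  "DU n = {\<sigma>. \<sigma> permutes {1..n} \<and>
     (\<forall>i \<in> {1..<n}. (odd i \<longrightarrow> \<sigma> i > \<sigma> (Suc i)) \<and> (even i \<longrightarrow> \<sigma> i < \<sigma> (Suc i)))}"

text \<open>
  The indices below are the lengths of the permutations. The values for \<^term>\<open>A_poly\<close> and
  \<^term>\<open>C_poly\<close> are used only at even lengths, those for \<^term>\<open>B_poly\<close> and
  \<^term>\<open>D_poly\<close> only at odd lengths.
\<close>

definition A_poly :: "nat \<Rightarrow> 'a::field_char_0 \<Rightarrow> 'a" where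
  "A_poly m x = (\<Sum>\<sigma>\<in>UD m. x ^ mmp1000 m \<sigma>)"

definition B_poly :: "nat \<Rightarrow> 'a::field_char_0 \<Rightarrow> 'a" where
  "B_poly m x = (\<Sum>\<sigma>\<in>UD m. x ^ mmp1000 m \<sigma>)"

definition C_poly :: "nat \<Rightarrow> 'a::field_char_0 \<Rightarrow> 'a" where
  "C_poly m x = (\<Sum>\<sigma>\<in>DU m. x ^ mmp1000 m \<sigma>)"

definition D_poly :: "nat \<Rightarrow> 'a::field_char_0 \<Rightarrow> 'a" where
  "D_poly m x = (\<Sum>\<sigma>\<in>DU m. x ^ mmp1000 m \<sigma>)"

text \<open>The formal variable of the series is t; x is an element of the coefficient field.\<close>

definition A_gf :: "'a::field_char_0 \<Rightarrow> 'a fps" where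
  "A_gf x = 1 + Abs_fps (\<lambda>m. if even m \<and> m \<ge> 1 then A_poly m x / fact m else 0)"

definition B_gf :: "'a::field_char_0 \<Rightarrow> 'a fps" where
  "B_gf x = Abs_fps (\<lambda>m. if odd m then B_poly m x / fact m else 0)"

definition C_gf :: "'a::field_char_0 \<Rightarrow> 'a fps" where
  "C_gf x = 1 + Abs_fps (\<lambda>m. if even m \<and> m \<ge> 1 then C_poly m x / fact m else 0)"

definition D_gf :: "'a::field_char_0 \<Rightarrow> 'a fps" where
  "D_gf x = Abs_fps (\<lambda>m. if odd m then D_poly m x / fact m else 0)"

text \<open>The series sec(ct), by analogy with \<^term>\<open>fps_cos c\<close>, which is cos(ct).\<close>

definition fps_sec :: "'a::field_char_0 \<Rightarrow> 'a fps" where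
  "fps_sec c = inverse (fps_cos c)"

text \<open>
  The power f^a for an exponent in the coefficient field, by the binomial series
  of (1 + (f - 1))^a. It is meaningful only if f has constant term 1.
\<close>

definition fps_gpow :: "'a::field_char_0 fps \<Rightarrow> 'a \<Rightarrow> 'a fps" where
  "fps_gpow f a = fps_binomial a oo (f - 1)"

lemma fps_sec_nth_0 [simp]: "fps_sec c $ 0 = 1"
  by (simp add: fps_sec_def fps_cos_def)

lemma fps_gpow_of_nat:
  assumes "f $ 0 = 1"
  shows "fps_gpow f (of_nat k) = f ^ k"
  using assms by (simp add: fps_gpow_def fps_binomial_of_nat fps_compose_add_distrib flip: fps_compose_power)

lemma fps_gpow_add:
  assumes "f $ 0 = 1"
  shows "fps_gpow f (a + b) = fps_gpow f a * fps_gpow f b"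
  using assms by (simp add: fps_gpow_def fps_binomial_add_mult fps_compose_mult_distrib)

end

(* Cut a permutation at its maximum. Every position before the maximum is counted by the statistic,
   the maximum itself is not, and the statistic of what follows is unaffected; so the left part
   contributes only its length and the number of alternating arrangements of its entries. The part
   after the maximum is always up-down. For the generating functions this reads
     A' = T A,  B' = 1 + T B,  C' = S B,  D' = S A,
   where T(t) = B(xt, 1) and S(t) = C(xt, 1). The case x = 1 of the same equations, rescaled, is
     T' = x (1 + T^2),  S' = x S T,
   so T = tan(xt) and S = sec(xt), and the linear equations for A, B, C, D have the stated
   solutions. *)

theory Submission
  imports Defs "HOL-Combinatorics.Multiset_Permutations"
begin

section \<open>Alternating lists and the statistic, cut at a maximum\<close>

text \<open>The flag tells whether the first step is an ascent. Entries lie in any linear order, so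
  parts of a permutation need no relabelling.\<close>

fun alternating :: "bool \<Rightarrow> 'a::linorder list \<Rightarrow> bool" where
  "alternating b (y # z # xs) \<longleftrightarrow> (if b then y < z else z < y) \<and> alternating (\<not> b) (z # xs)"
| "alternating b xs \<longleftrightarrow> True"

fun exceeded :: "'a::linorder list \<Rightarrow> nat" where
  "exceeded [] = 0"
| "exceeded (y # xs) = (if \<exists>z\<in>set xs. y < z then 1 else 0) + exceeded xs"

lemma alternating_Cons_max:
  assumes "\<forall>y\<in>set rs. y < m"
  shows "alternating b (m # rs) \<longleftrightarrow> alternating True rs \<and> (\<not> b \<or> rs = [])"
  using assms by (cases rs) auto

text \<open>The step into \<open>m\<close>, number \<open>length ls\<close>, must be an ascent,
  which ties its parity to \<open>b\<close>; the descent out of \<open>m\<close> imposes the same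
  condition. Only the one-entry list has neither step.\<close>

lemma alternating_append_max:
  assumes "\<forall>y\<in>set ls \<union> set rs. y < m"
  shows "alternating b (ls @ m # rs) \<longleftrightarrow> alternating b ls \<and> alternating True rs \<and>
    (odd (length ls) = b \<or> ls = [] \<and> rs = [])"
  using assms
proof (induction b ls rule: alternating.induct)
  case (1 b y z xs)
  then show ?case by auto
qed (auto simp: alternating_Cons_max)

lemma exceeded_append_max:
  assumes "\<forall>y\<in>set ls \<union> set rs. y < m"
  shows "exceeded (ls @ m # rs) = length ls + exceeded rs"
  using assms by (induction ls) (auto dest: less_asym)

text \<open>Links the recursion to the pointwise conditions of \<open>UD\<close> and
  \<open>DU\<close>; indices count from 0, so \<open>even i = b\<close> marks the ascents.\<close>

lemma alternating_iff_nth: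
  "alternating b xs \<longleftrightarrow>
    (\<forall>i. Suc i < length xs \<longrightarrow> (if even i = b then xs ! i < xs ! Suc i else xs ! Suc i < xs ! i))"
proof (induction b xs rule: alternating.induct)
  case (1 b y z xs)
  have "(\<forall>i. Suc i < length (y # z # xs) \<longrightarrow> P i) \<longleftrightarrow>
      P 0 \<and> (\<forall>i. Suc i < length (z # xs) \<longrightarrow> P (Suc i))" for P
    by (metis Suc_less_eq length_Cons not0_implies_Suc zero_less_Suc)
  then show ?case
    unfolding alternating.simps "1.IH" by simp
qed auto

lemma exceeded_eq_card:
  "exceeded xs = card {i. i < length xs \<and> (\<exists>j. i < j \<and> j < length xs \<and> xs ! i < xs ! j)}"
proof (induction xs)
  case (Cons y xs)
  let ?M = "\<lambda>xs. {i. i < length xs \<and> (\<exists>j. i < j \<and> j < length xs \<and> xs ! i < xs ! j)}"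
  have "?M (y # xs) = (if \<exists>z\<in>set xs. y < z then {0} else {}) \<union> Suc ` ?M xs"
  proof (intro set_eqI)
    fix i
    show "i \<in> ?M (y # xs) \<longleftrightarrow> i \<in> (if \<exists>z\<in>set xs. y < z then {0} else {}) \<union> Suc ` ?M xs"
    proof (cases i)
      case 0
      have "(\<exists>j. 0 < j \<and> j < length (y # xs) \<and> y < (y # xs) ! j) \<longleftrightarrow> (\<exists>z\<in>set xs. y < z)"
        by (force simp: in_set_conv_nth gr0_conv_Suc)
      then show ?thesis
        using 0 by auto
    next
      case (Suc k)
      then show ?thesis
        by (auto simp: Suc_less_eq2 inj_image_mem_iff)
    qed
  qed
  moreover have "card (Suc ` ?M xs) = exceeded xs"
    by (simp add: card_image Cons.IH)
  ultimately show ?case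
    by (auto simp: card_insert_if)
qed simp

section \<open>Weighted sums over the arrangements of a set\<close>

definition weight_sum :: "bool \<Rightarrow> 'b::linorder set \<Rightarrow> 'a::comm_semiring_1 \<Rightarrow> 'a" where
  "weight_sum b S x = (\<Sum>xs | xs \<in> permutations_of_set S \<and> alternating b xs. x ^ exceeded xs)"

lemma weight_sum_eq_sum_if:
  "weight_sum b S x = (\<Sum>xs\<in>permutations_of_set S. if alternating b xs then x ^ exceeded xs else 0)"
  unfolding weight_sum_def by (subst sum.inter_filter[symmetric]) auto

text \<open>As \<open>m\<close> occurs exactly once, the list determines the cut. The component
  \<open>T\<close> repeats the entries of \<open>ls\<close> and sorts the pairs by the set of the
  left part.\<close>

lemma permutations_of_set_split:
  assumes "m \<notin> S"
  shows "bij_betw (\<lambda>(T, ls, rs). ls @ m # rs)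
    (SIGMA T:Pow S. permutations_of_set T \<times> permutations_of_set (S - T))
    (permutations_of_set (insert m S))"
  unfolding bij_betw_def
proof
  show "inj_on (\<lambda>(T, ls, rs). ls @ m # rs)
      (SIGMA T:Pow S. permutations_of_set T \<times> permutations_of_set (S - T))"
  proof (rule inj_onI)
    fix p q
    assume p: "p \<in> (SIGMA T:Pow S. permutations_of_set T \<times> permutations_of_set (S - T))"
      and q: "q \<in> (SIGMA T:Pow S. permutations_of_set T \<times> permutations_of_set (S - T))"
      and eq: "(\<lambda>(T, ls, rs). ls @ m # rs) p = (\<lambda>(T, ls, rs). ls @ m # rs) q"
    obtain T ls rs T' ls' rs' where pq: "p = (T, ls, rs)" "q = (T', ls', rs')"
      by (meson prod_cases3)
    have sets: "T = set ls" "T' = set ls'" "set ls \<subseteq> S" "set rs \<subseteq> S"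
      using p q unfolding pq permutations_of_set_def by simp_all
    then have "m \<notin> set ls" "m \<notin> set rs"
      using assms by (meson subsetD)+
    then have "ls = ls' \<and> rs = rs'"
      using eq unfolding pq prod.case by (rule append_Cons_eq_iff[THEN iffD1])
    then show "p = q"
      using sets(1,2) unfolding pq by metis
  qed
  show "(\<lambda>(T, ls, rs). ls @ m # rs) `
      (SIGMA T:Pow S. permutations_of_set T \<times> permutations_of_set (S - T)) =
      permutations_of_set (insert m S)"
  proof (intro equalityI subsetI)
    fix xs assume "xs \<in> permutations_of_set (insert m S)"
    then have xs: "set xs = insert m S" "distinct xs"
      by (auto simp: permutations_of_set_def)
    then obtain ls rs where ls: "xs = ls @ m # rs"
      by (metis insertI1 split_list)
    have "(set ls, ls, rs) \<in> (SIGMA T:Pow S. permutations_of_set T \<times> permutations_of_set (S - T))"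
      using xs assms by (auto simp: ls permutations_of_set_def)
    then show "xs \<in> (\<lambda>(T, ls, rs). ls @ m # rs) `
      (SIGMA T:Pow S. permutations_of_set T \<times> permutations_of_set (S - T))"
      unfolding ls by (rule image_eqI[rotated]) simp
  qed (use assms in \<open>auto simp: permutations_of_set_def\<close>)
qed

text \<open>Entries left of \<open>m\<close> are all exceeded, so the left part contributes
  \<open>x ^ card T\<close> times a mere count, its weighted sum at 1. The disjunct
  \<open>S = {}\<close> admits the single entry under both flags.\<close>

lemma weight_sum_insert_max:
  assumes "finite S" "\<forall>y\<in>S. y < m"
  shows "weight_sum b (insert m S) x =
    (\<Sum>T\<in>Pow S. if odd (card T) = b \<or> S = {}
       then x ^ card T * weight_sum b T 1 * weight_sum True (S - T) x else 0)"
proof -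
  have m: "m \<notin> S" using assms(2) by auto
  have "weight_sum b (insert m S) x =
      (\<Sum>xs\<in>permutations_of_set (insert m S). if alternating b xs then x ^ exceeded xs else 0)"
    by (rule weight_sum_eq_sum_if)
  also have "\<dots> = (\<Sum>(T, ls, rs)\<in>(SIGMA T:Pow S. permutations_of_set T \<times> permutations_of_set (S - T)).
      if alternating b (ls @ m # rs) then x ^ exceeded (ls @ m # rs) else 0)"
    by (subst sum.reindex_bij_betw[OF permutations_of_set_split[OF m], symmetric])
       (rule sum.cong, auto)
  also have "\<dots> = (\<Sum>T\<in>Pow S. \<Sum>(ls, rs)\<in>permutations_of_set T \<times> permutations_of_set (S - T).
      if alternating b (ls @ m # rs) then x ^ exceeded (ls @ m # rs) else 0)"
    using assms(1) by (subst sum.Sigma) auto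
  also have "\<dots> = (\<Sum>T\<in>Pow S. if odd (card T) = b \<or> S = {}
       then x ^ card T * weight_sum b T 1 * weight_sum True (S - T) x else 0)"
  proof (rule sum.cong[OF refl])
    fix T assume T: "T \<in> Pow S"
    let ?c = "odd (card T) = b \<or> S = {}"
    have "(\<Sum>(ls, rs)\<in>permutations_of_set T \<times> permutations_of_set (S - T).
        if alternating b (ls @ m # rs) then x ^ exceeded (ls @ m # rs) else 0) =
      (\<Sum>(ls, rs)\<in>permutations_of_set T \<times> permutations_of_set (S - T).
        (if ?c then x ^ card T else 0) * ((if alternating b ls then 1 else 0) *
        (if alternating True rs then x ^ exceeded rs else 0)))"
    proof (intro sum.cong[OF refl], clarify)
      fix ls rs assume lr: "ls \<in> permutations_of_set T" "rs \<in> permutations_of_set (S - T)"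
      then have lt: "\<forall>y\<in>set ls \<union> set rs. y < m"
        using assms(2) T by (auto simp: permutations_of_set_def)
      have len: "length ls = card T"
        using lr by (auto simp: permutations_of_set_def distinct_card)
      \<comment> \<open>Makes the exceptional case independent of the two lists, so that the sum
        over them can factor.\<close>
      have emp: "ls = [] \<and> rs = [] \<longleftrightarrow> S = {}"
        using lr T by (auto simp: permutations_of_set_def)
      show "(if alternating b (ls @ m # rs) then x ^ exceeded (ls @ m # rs) else 0) =
        (if ?c then x ^ card T else 0) * ((if alternating b ls then 1 else 0) *
        (if alternating True rs then x ^ exceeded rs else 0))"
        unfolding alternating_append_max[OF lt] exceeded_append_max[OF lt] emp len
        by (cases "odd (card T) = b") (auto simp: power_add)
    qed
    also have "\<dots> = (if ?c then x ^ card T else 0) *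
        ((\<Sum>ls\<in>permutations_of_set T. if alternating b ls then 1 else 0) *
         (\<Sum>rs\<in>permutations_of_set (S - T). if alternating True rs then x ^ exceeded rs else 0))"
      unfolding sum_product sum.cartesian_product by (simp add: sum_distrib_left case_prod_unfold)
    also have "\<dots> = (if ?c then x ^ card T * weight_sum b T 1 * weight_sum True (S - T) x else 0)"
      by (simp add: weight_sum_eq_sum_if mult.assoc cong: if_cong)
    finally show "(\<Sum>(ls, rs)\<in>permutations_of_set T \<times> permutations_of_set (S - T).
        if alternating b (ls @ m # rs) then x ^ exceeded (ls @ m # rs) else 0) =
      (if ?c then x ^ card T * weight_sum b T 1 * weight_sum True (S - T) x else 0)" .
  qed
  finally show ?thesis .
qed

lemma sum_Pow_card:
  fixes f :: "nat \<Rightarrow> 'a::comm_semiring_1"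
  assumes "finite S"
  shows "(\<Sum>T\<in>Pow S. f (card T)) = (\<Sum>l\<le>card S. of_nat (card S choose l) * f l)"
proof -
  have "(\<Sum>T\<in>Pow S. f (card T)) = (\<Sum>l\<le>card S. \<Sum>T | T \<in> Pow S \<and> card T = l. f (card T))"
    using assms by (intro sum.group[symmetric]) (auto intro: card_mono)
  also have "\<dots> = (\<Sum>l\<le>card S. of_nat (card S choose l) * f l)"
    using n_subsets[OF assms] by (intro sum.cong) auto
  finally show ?thesis .
qed

text \<open>The recursion of \<open>weight_sum_insert_max\<close> with left sets grouped by their
  size \<open>l\<close>. At \<open>x = 1\<close> the values are the Euler zigzag numbers.\<close>

fun alt_poly :: "bool \<Rightarrow> nat \<Rightarrow> 'a::comm_semiring_1 \<Rightarrow> 'a" where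
  "alt_poly b 0 x = 1"
| "alt_poly b (Suc n) x = (\<Sum>l\<le>n. of_nat (n choose l) * (if odd l = b \<or> n = 0
     then x ^ l * alt_poly b l 1 * alt_poly True (n - l) x else 0))"

text \<open>Removing \<open>Max S\<close> and splitting the rest gives two smaller sets. The
  induction hypothesis is needed with flag \<open>b\<close> at 1 and flag \<open>True\<close> at
  \<open>x\<close>, so both vary.\<close>

lemma weight_sum_eq_alt_poly:
  assumes "finite S"
  shows "weight_sum b S x = alt_poly b (card S) x"
  using assms
proof (induction "card S" arbitrary: S b x rule: less_induct)
  case less
  show ?case
  proof (cases "S = {}")
    case True
    then show ?thesis by (simp add: weight_sum_def Collect_conv_if)
  next
    case False
    define R where "R = S - {Max S}"
    have S: "insert (Max S) R = S"
      unfolding R_def by (rule insert_Diff[OF Max_in[OF less.prems False]])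
    have fin: "finite R"
      using less.prems by (simp add: R_def)
    have card: "card S = Suc (card R)"
      using card.insert[OF fin, of "Max S"] unfolding S by (simp add: R_def)
    have R: "\<forall>y\<in>R. y < Max S"
      using less.prems by (auto simp: R_def order.strict_iff_order)
    have "weight_sum b S x = (\<Sum>T\<in>Pow R. if odd (card T) = b \<or> R = {}
       then x ^ card T * weight_sum b T 1 * weight_sum True (R - T) x else 0)"
      using weight_sum_insert_max[OF fin R] unfolding S .
    also have "\<dots> = (\<Sum>T\<in>Pow R. if odd (card T) = b \<or> card R = 0
       then x ^ card T * alt_poly b (card T) 1 * alt_poly True (card R - card T) x else 0)"
    proof (rule sum.cong[OF refl])
      fix T assume T: "T \<in> Pow R"
      then have "card T < card S" "finite T"
        using fin card by (auto simp: less_Suc_eq_le intro: card_mono finite_subset)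
      moreover have "card (R - T) = card R - card T"
        using T fin by (auto intro: card_Diff_subset finite_subset)
      ultimately show "(if odd (card T) = b \<or> R = {}
          then x ^ card T * weight_sum b T 1 * weight_sum True (R - T) x else 0) =
        (if odd (card T) = b \<or> card R = 0
          then x ^ card T * alt_poly b (card T) 1 * alt_poly True (card R - card T) x else 0)"
        using fin card less.hyps[of T] less.hyps[of "R - T"] by simp
    qed
    also have "\<dots> = alt_poly b (card S) x"
      unfolding card alt_poly.simps by (rule sum_Pow_card[OF fin])
    finally show ?thesis .
  qed
qed

section \<open>From permutations to lists\<close>

text \<open>One-line notation is injective, and surjectivity follows by counting: both sides have n!
  elements.\<close>

lemma bij_betw_permutes_permutations_of_set:
  "bij_betw (\<lambda>\<sigma>. map \<sigma> [1..<Suc n]) {\<sigma>. \<sigma> permutes {1..n}} (permutations_of_set {1..n})"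
proof -
  let ?f = "\<lambda>\<sigma>. map \<sigma> [1..<Suc n]"
  let ?P = "{\<sigma>. \<sigma> permutes {1..n}}"
  have inj: "inj_on ?f ?P"
  proof (rule inj_onI)
    fix \<sigma> \<tau> assume st: "\<sigma> \<in> ?P" "\<tau> \<in> ?P" "?f \<sigma> = ?f \<tau>"
    show "\<sigma> = \<tau>"
    proof
      fix i
      show "\<sigma> i = \<tau> i"
        using st by (cases "i \<in> {1..n}") (auto simp: permutes_not_in simp del: upt_Suc)
    qed
  qed
  have sub: "?f ` ?P \<subseteq> permutations_of_set {1..n}"
  proof clarify
    fix \<sigma> assume s: "\<sigma> permutes {1..n}"
    have "set (?f \<sigma>) = \<sigma> ` {1..n}"
      by (simp add: atLeastLessThanSuc_atLeastAtMost del: upt_Suc)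
    then show "?f \<sigma> \<in> permutations_of_set {1..n}"
      using s permutes_image[OF s]
      by (auto simp: permutations_of_set_def distinct_map permutes_inj_on simp del: upt_Suc)
  qed
  have "card (?f ` ?P) = card (permutations_of_set {1..n})"
    using card_permutations[of "{1..n}" n] card_image[OF inj] by (simp del: upt_Suc)
  then show ?thesis
    using sub inj by (simp add: bij_betw_def card_subset_eq del: upt_Suc)
qed

lemma mmp1000_eq_exceeded: "mmp1000 n \<sigma> = exceeded (map \<sigma> [1..<Suc n])"
proof -
  let ?xs = "map \<sigma> [1..<Suc n]"
  have "{i \<in> {1..n}. \<exists>j \<in> {1..n}. i < j \<and> \<sigma> i < \<sigma> j} =
    Suc ` {i. i < n \<and> (\<exists>j. i < j \<and> j < n \<and> \<sigma> (Suc i) < \<sigma> (Suc j))}" (is "?L = Suc ` ?R")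
  proof (intro equalityI subsetI)
    fix i assume "i \<in> ?L"
    then obtain j where "1 \<le> i" "i \<le> n" "j \<le> n" "i < j" "\<sigma> i < \<sigma> j" by auto
    \<comment> \<open>Positions start at 1 and list indices at 0, hence the witnesses
      \<open>i - 1\<close> and \<open>j - 1\<close>.\<close>
    then show "i \<in> Suc ` ?R"
      by (intro image_eqI[of _ _ "i - 1"]) (auto intro!: exI[of _ "j - 1"])
  qed auto
  then have "mmp1000 n \<sigma> = card ?R"
    by (simp add: mmp1000_def card_image)
  also have "?R = {i. i < length ?xs \<and> (\<exists>j. i < j \<and> j < length ?xs \<and> ?xs ! i < ?xs ! j)}"
    by (rule Collect_cong) (auto simp del: upt_Suc)
  finally show ?thesis
    by (simp only: exceeded_eq_card)
qed

lemma alternating_map_iff: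
  "alternating b (map \<sigma> [1..<Suc n]) \<longleftrightarrow>
    (\<forall>i\<in>{1..<n}. if odd i = b then \<sigma> i < \<sigma> (Suc i) else \<sigma> (Suc i) < \<sigma> i)"
proof -
  have "(\<forall>i\<in>{1..<n}. P i) \<longleftrightarrow> (\<forall>i. Suc i < n \<longrightarrow> P (Suc i))" for P
    by (auto simp: Ball_def) (metis Suc_pred less_eq_Suc_le)
  then show ?thesis
    by (simp add: alternating_iff_nth del: upt_Suc)
qed

text \<open>One-line notation restricts to a bijection from \<open>U\<close> onto the alternating
  lists; a general \<open>U\<close> serves \<open>UD\<close> and \<open>DU\<close> alike.\<close>

lemma sum_alternating_permutations:
  assumes "\<And>\<sigma>. \<sigma> \<in> U \<longleftrightarrow> \<sigma> permutes {1..n} \<and> alternating b (map \<sigma> [1..<Suc n])"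
  shows "(\<Sum>\<sigma>\<in>U. x ^ mmp1000 n \<sigma>) = alt_poly b n x"
proof -
  let ?f = "\<lambda>\<sigma>. map \<sigma> [1..<Suc n]"
  have "?f ` U = {xs \<in> ?f ` {\<sigma>. \<sigma> permutes {1..n}}. alternating b xs}"
    using assms by (auto simp del: upt_Suc)
  also have "?f ` {\<sigma>. \<sigma> permutes {1..n}} = permutations_of_set {1..n}"
    by (rule bij_betw_imp_surj_on[OF bij_betw_permutes_permutations_of_set])
  finally have "bij_betw ?f U {xs \<in> permutations_of_set {1..n}. alternating b xs}"
    using assms by (intro bij_betw_subset[OF bij_betw_permutes_permutations_of_set]) auto
  then have "(\<Sum>\<sigma>\<in>U. x ^ exceeded (?f \<sigma>)) = weight_sum b {1..n} x"
    unfolding weight_sum_def by (rule sum.reindex_bij_betw)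
  then show ?thesis
    by (simp add: mmp1000_eq_exceeded weight_sum_eq_alt_poly del: upt_Suc)
qed

lemma sum_UD: "(\<Sum>\<sigma>\<in>UD n. x ^ mmp1000 n \<sigma>) = alt_poly True n x"
  by (rule sum_alternating_permutations) (simp only: UD_def alternating_map_iff mem_Collect_eq, auto simp: if_bool_eq_conj)

lemma sum_DU: "(\<Sum>\<sigma>\<in>DU n. x ^ mmp1000 n \<sigma>) = alt_poly False n x"
  by (rule sum_alternating_permutations) (simp only: DU_def alternating_map_iff mem_Collect_eq, auto simp: if_bool_eq_conj)

section \<open>Generating functions and their differential equations\<close>

text \<open>
  The scaling \<^term>\<open>y\<close> of the formal variable absorbs the factor x^l that a part of length l
  before the maximum contributes.
\<close>

definition alt_gf :: "bool \<Rightarrow> bool \<Rightarrow> 'a::field_char_0 \<Rightarrow> 'a \<Rightarrow> 'a fps" where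
  "alt_gf b p y x = Abs_fps (\<lambda>m. if odd m = p then y ^ m * alt_poly b m x / fact m else 0)"

lemma alt_gf_nth_0: "alt_gf b p y x $ 0 = (if p then 0 else 1)"
  by (simp add: alt_gf_def)

text \<open>A binomial convolution becomes a product. The left length has parity \<open>b\<close>
  and the total is one more than both lengths together, so the right length is odd exactly when
  \<open>p = b\<close>. The summand 1 is the one-entry list for \<open>b\<close> true; for
  \<open>b\<close> false the product already contains it.\<close>

lemma fps_deriv_alt_gf:
  "fps_deriv (alt_gf b p y x) =
    fps_const y * ((if b \<and> p then 1 else 0) + alt_gf b b (x * y) 1 * alt_gf True (p = b) y x)"
proof (rule fps_ext)
  fix n
  let ?u = "\<lambda>l. alt_gf b b (x * y) 1 $ l * alt_gf True (p = b) y x $ (n - l)"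
  let ?c = "\<lambda>l. if odd l = b \<or> n = 0 then x ^ l * alt_poly b l 1 * alt_poly True (n - l) x else 0"
  have "fps_deriv (alt_gf b p y x) $ n =
    (if odd n \<noteq> p then y * (y ^ n / fact n * (\<Sum>l\<le>n. of_nat (n choose l) * ?c l)) else 0)"
    unfolding fps_deriv_nth alt_gf_def fps_nth_Abs_fps Suc_eq_plus1[symmetric]
      alt_poly.simps by (simp add: fact_Suc field_simps del: alt_poly.simps of_nat_Suc)
  also have "\<dots> = y * ((if b \<and> p \<and> n = 0 then 1 else 0) + (\<Sum>l\<le>n. ?u l))"
  proof (cases "n = 0")
    case True
    then show ?thesis by (auto simp: alt_gf_def)
  next
    case False
    \<comment> \<open>Factorials absorb the binomial coefficient, and \<open>x ^ l\<close> joins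
      \<open>y ^ l\<close> to form the scaling \<open>x * y\<close>.\<close>
    have "y ^ n / fact n * (of_nat (n choose l) * ?c l) = ?u l" if "l \<le> n" "odd n \<noteq> p" for l
    proof -
      have "y ^ n = y ^ l * y ^ (n - l)"
        using that by (simp flip: power_add)
      then show ?thesis
        using that False by (auto simp: alt_gf_def binomial_fact power_mult_distrib)
    qed
    \<comment> \<open>For this parity of \<open>n\<close>, no \<open>l\<close> gives both parts the
      required parity.\<close>
    moreover have "?u l = 0" if "l \<le> n" "odd n = p" for l
      using that by (auto simp: alt_gf_def)
    then have "(\<Sum>l\<le>n. ?u l) = 0" if "odd n = p"
      using that by (intro sum.neutral) simp
    ultimately show ?thesis
      using False by (cases "odd n = p") (simp_all add: sum_distrib_left)
  qed
  also have "\<dots> = (fps_const y * ((if b \<and> p then 1 else 0) +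
      alt_gf b b (x * y) 1 * alt_gf True (p = b) y x)) $ n"
    unfolding fps_mult_left_const_nth fps_add_nth by (simp add: fps_mult_nth atLeast0AtMost)
  finally show "fps_deriv (alt_gf b p y x) $ n = (fps_const y * ((if b \<and> p then 1 else 0) +
      alt_gf b b (x * y) 1 * alt_gf True (p = b) y x)) $ n" .
qed

section \<open>Linear differential equations for power series\<close>

text \<open>The equation determines coefficient \<open>Suc k\<close> of \<open>Y\<close> from those
  up to \<open>k\<close>, the division by \<open>Suc k\<close> being possible in characteristic
  0.\<close>

lemma fps_linear_ODE_zero:
  fixes Y G :: "'a::field_char_0 fps"
  assumes "fps_deriv Y = G * Y" "Y $ 0 = 0"
  shows "Y = 0"
proof (rule fps_ext)
  fix n
  show "Y $ n = 0 $ n"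
  proof (induction n rule: less_induct)
    case (less n)
    show ?case
    proof (cases n)
      case (Suc k)
      have "of_nat (Suc k) * Y $ Suc k = (G * Y) $ k"
        by (simp flip: assms(1) del: of_nat_Suc)
      also have "\<dots> = 0"
        using less.IH Suc by (auto simp: fps_mult_nth intro!: sum.neutral)
      finally show ?thesis using Suc by (simp del: of_nat_Suc)
    qed (simp add: assms(2))
  qed
qed

lemma fps_linear_ODE_unique:
  fixes Y Z G H :: "'a::field_char_0 fps"
  assumes "fps_deriv Y = H + G * Y" "fps_deriv Z = H + G * Z" "Y $ 0 = Z $ 0"
  shows "Y = Z"
proof -
  have "Y - Z = 0"
    by (rule fps_linear_ODE_zero[of _ G]) (simp_all add: assms algebra_simps)
  then show ?thesis by simp
qed

section \<open>Tangent and secant\<close>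

text \<open>By T' = x (1 + T^2), the series T cos - sin solves the homogeneous linear equation with
  coefficient x T and vanishes at 0.\<close>

lemma alt_gf_scaled_tan: "alt_gf True True x 1 * fps_cos x = fps_sin x"
proof -
  define T where "T = alt_gf True True x 1"
  have T: "fps_deriv T = fps_const x * (1 + T * T)"
    by (simp add: T_def fps_deriv_alt_gf)
  have "T * fps_cos x - fps_sin x = 0"
  proof (rule fps_linear_ODE_zero)
    show "fps_deriv (T * fps_cos x - fps_sin x) = (fps_const x * T) * (T * fps_cos x - fps_sin x)"
      by (simp add: T fps_sin_deriv fps_cos_deriv algebra_simps flip: fps_const_neg)
  qed (simp add: T_def alt_gf_nth_0)
  then show ?thesis by (simp add: T_def)
qed

lemma fps_sec_times_cos: "fps_sec c * fps_cos c = 1"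
  unfolding fps_sec_def by (rule inverse_mult_eq_1) simp

text \<open>The derivative of S cos is x S (T cos - sin) = 0, so S cos equals its constant term
  1.\<close>

lemma alt_gf_scaled_sec: "alt_gf False False x 1 = fps_sec x"
proof -
  define S where "S = alt_gf False False x 1"
  define T where "T = alt_gf True True x 1"
  have S: "fps_deriv S = fps_const x * (S * T)"
    by (simp add: S_def T_def fps_deriv_alt_gf)
  have "fps_deriv (S * fps_cos x) = fps_const x * S * (T * fps_cos x - fps_sin x)"
    by (simp add: S fps_cos_deriv algebra_simps flip: fps_const_neg)
  also have "\<dots> = 0"
    by (simp add: T_def alt_gf_scaled_tan)
  finally have "S * fps_cos x = fps_const ((S * fps_cos x) $ 0)"
    by (simp only: fps_deriv_eq_0_iff)
  then have "S * fps_cos x = 1"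
    by (simp add: S_def alt_gf_nth_0)
  then have "S * (fps_sec x * fps_cos x) = fps_sec x"
    by (simp add: mult.left_commute mult.commute)
  then show ?thesis
    by (simp add: S_def fps_sec_times_cos)
qed

lemma fps_deriv_sec: "fps_deriv (fps_sec x) = fps_const x * (fps_sec x * alt_gf True True x 1)"
  using fps_deriv_alt_gf[of False False x 1] by (simp add: alt_gf_scaled_sec)

section \<open>Powers of the secant\<close>

lemma fps_gpow_nth_0: "fps_gpow f a $ 0 = 1"
  by (simp add: fps_gpow_def)

text \<open>The binomial series solves (1 + X) b' = a b. Substituting f - 1 for X turns 1 + X into
  f, and the chain rule does the rest; keeping the factor \<open>f\<close> avoids a
  quotient.\<close>

lemma fps_deriv_gpow:
  assumes "f $ 0 = 1"
  shows "f * fps_deriv (fps_gpow f a) = fps_const a * fps_deriv f * fps_gpow f a"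
proof -
  let ?b = "fps_binomial a"
  have f: "(f - 1) $ 0 = 0" using assms by simp
  have "(1 + fps_X) * fps_deriv ?b = fps_const a * ?b"
    by (simp add: fps_binomial_deriv fps_divide_unit mult.left_commute[of _ _ "inverse _"]
        inverse_mult_eq_1' flip: mult.assoc)
  then have "((1 + fps_X) * fps_deriv ?b) oo (f - 1) = (fps_const a * ?b) oo (f - 1)"
    by simp
  then have "f * (fps_deriv ?b oo (f - 1)) = fps_const a * fps_gpow f a"
    by (simp add: fps_compose_mult_distrib[OF f] fps_compose_add_distrib fps_gpow_def
        fps_X_fps_compose_startby0[OF f])
  then show ?thesis
    unfolding fps_gpow_def fps_compose_deriv[OF f] by (simp add: algebra_simps)
qed

text \<open>The logarithmic derivative of sec(xt) is x tan(xt), and the power multiplies it by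
  \<open>a\<close>.\<close>

lemma fps_deriv_gpow_sec:
  "fps_deriv (fps_gpow (fps_sec x) a) = fps_const (a * x) * alt_gf True True x 1 * fps_gpow (fps_sec x) a"
proof -
  have "fps_sec x * fps_deriv (fps_gpow (fps_sec x) a) =
    fps_sec x * (fps_const (a * x) * alt_gf True True x 1 * fps_gpow (fps_sec x) a)"
    by (simp add: fps_deriv_gpow fps_deriv_sec algebra_simps flip: fps_const_mult)
  moreover have "fps_sec x \<noteq> 0"
    using fps_sec_nth_0[of x] by (metis fps_zero_nth zero_neq_one)
  ultimately show ?thesis by simp
qed

section \<open>Solving for the four series\<close>

lemma A_gf_eq_alt_gf: "A_gf x = alt_gf True False 1 x"
  by (rule fps_ext) (auto simp: A_gf_def A_poly_def sum_UD alt_gf_def)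

lemma B_gf_eq_alt_gf: "B_gf x = alt_gf True True 1 x"
  by (rule fps_ext) (auto simp: B_gf_def B_poly_def sum_UD alt_gf_def)

lemma C_gf_eq_alt_gf: "C_gf x = alt_gf False False 1 x"
  by (rule fps_ext) (auto simp: C_gf_def C_poly_def sum_DU alt_gf_def)

lemma D_gf_eq_alt_gf: "D_gf x = alt_gf False True 1 x"
  by (rule fps_ext) (auto simp: D_gf_def D_poly_def sum_DU alt_gf_def)

theorem theorem1p2:
  fixes x :: "'a::field_char_0"
  assumes "x \<noteq> 0"
  shows "A_gf x = fps_gpow (fps_sec x) (1 / x)
    \<and> B_gf x = fps_gpow (fps_sec x) (1 / x) * fps_integral0 (fps_gpow (fps_sec x) (- (1 / x)))
    \<and> C_gf x = 1 + fps_integral0 (fps_gpow (fps_sec x) (1 + 1 / x)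
                      * fps_integral0 (fps_gpow (fps_sec x) (- (1 / x))))
    \<and> D_gf x = fps_integral0 (fps_gpow (fps_sec x) (1 + 1 / x))"
proof -
  define T where "T = alt_gf True True x 1"
  define G where "G = fps_gpow (fps_sec x) (1 / x)"
  define H where "H = fps_gpow (fps_sec x) (- (1 / x))"
  \<comment> \<open>The exponent 1/x gives the coefficient (1/x) x = 1, where
    \<open>x \<noteq> 0\<close> enters; \<open>0 +\<close> fits the shape of
    \<open>fps_linear_ODE_unique\<close>.\<close>
  have G: "fps_deriv G = 0 + T * G"
    using assms by (simp add: G_def T_def fps_deriv_gpow_sec)
  have GH: "G * H = 1"
    using fps_gpow_add[of "fps_sec x" "1 / x" "- (1 / x)"] fps_gpow_of_nat[of "fps_sec x" 0]
    by (simp add: G_def H_def)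
  have K: "fps_gpow (fps_sec x) (1 + 1 / x) = fps_sec x * G"
    using fps_gpow_add[of "fps_sec x" 1 "1 / x"] fps_gpow_of_nat[of "fps_sec x" 1]
    by (simp add: G_def)
  have A: "A_gf x = G"
    by (rule fps_linear_ODE_unique[OF _ G])
       (simp_all add: A_gf_eq_alt_gf fps_deriv_alt_gf T_def alt_gf_nth_0 G_def fps_gpow_nth_0)
  \<comment> \<open>Variation of constants: as G' = T G and G H = 1, the derivative of G times the
    integral of H is 1 plus T times that product.\<close>
  have B: "B_gf x = G * fps_integral0 H"
  proof (rule fps_linear_ODE_unique)
    show "fps_deriv (B_gf x) = 1 + T * B_gf x"
      by (simp add: B_gf_eq_alt_gf fps_deriv_alt_gf T_def)
    show "fps_deriv (G * fps_integral0 H) = 1 + T * (G * fps_integral0 H)"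
      by (simp add: G GH fps_deriv_fps_integral mult.assoc)
    show "B_gf x $ 0 = (G * fps_integral0 H) $ 0"
      by (simp add: B_gf_eq_alt_gf alt_gf_nth_0)
  qed
  \<comment> \<open>The right side of C' = S B is already known, so uniqueness with coefficient 0
    only compares derivatives and constant terms; the same holds for D.\<close>
  have C: "C_gf x = 1 + fps_integral0 (fps_sec x * G * fps_integral0 H)"
  proof (rule fps_linear_ODE_unique)
    show "fps_deriv (C_gf x) = fps_sec x * B_gf x + 0 * C_gf x"
      by (simp add: C_gf_eq_alt_gf B_gf_eq_alt_gf fps_deriv_alt_gf alt_gf_scaled_sec)
    show "fps_deriv (1 + fps_integral0 (fps_sec x * G * fps_integral0 H)) =
        fps_sec x * B_gf x + 0 * (1 + fps_integral0 (fps_sec x * G * fps_integral0 H))"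
      by (simp add: fps_deriv_fps_integral B mult.assoc)
  qed (simp add: C_gf_eq_alt_gf alt_gf_nth_0)
  have D: "D_gf x = fps_integral0 (fps_sec x * G)"
  proof (rule fps_linear_ODE_unique)
    show "fps_deriv (D_gf x) = fps_sec x * A_gf x + 0 * D_gf x"
      by (simp add: D_gf_eq_alt_gf A_gf_eq_alt_gf fps_deriv_alt_gf alt_gf_scaled_sec)
    show "fps_deriv (fps_integral0 (fps_sec x * G)) =
        fps_sec x * A_gf x + 0 * fps_integral0 (fps_sec x * G)"
      by (simp add: fps_deriv_fps_integral A)
  qed (simp add: D_gf_eq_alt_gf alt_gf_nth_0)
  show ?thesis
    unfolding K using A B C D by (simp add: G_def H_def)
qed

end
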